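(* Let $G$ be an $r$-regular interval colorable graph and let $n\geq 2$ be an integer. Then $G\square C_{2n}$ is interval colorable and $$W(G\square C_{2n})\geq W(G)+W(C_{2n})+nr,$$ where $W(C_{2n})=n+1$.
   Context: All graphs are finite, undirected, without loops or multiple edges. An edge-coloring of a graph $G$ with colors $1,\ldots,t$ is an interval $t$-coloring if all $t$ colors are used, and the colors of the edges incident to each vertex are distinct and form an interval of consecutive integers. A graph is interval colorable if it has an interval $t$-coloring for some positive integer $t$; for such a graph, $W(G)$ is the greatest such $t$. $C_{2n}$ is the cycle on $2n$ vertices. The Cartesian product $G\square H$ has vertex set $V(G)\times V(H)$, with $(u_1,v_1)(u_2,v_2)$ an edge iff either $u_1=u_2$ and $v_1v_2\in E(H)$, or $v_1=v_2$ and $u_1u_2\in E(G)$. *)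

theory Defs
  imports Main
begin

record 'a graph =
  verts :: "'a set"
  edges :: "'a set set"

definition simple_graph :: "'a graph \<Rightarrow> bool" where
  "simple_graph G \<longleftrightarrow> finite (verts G) \<and> (\<forall>e\<in>edges G. e \<subseteq> verts G \<and> card e = 2)"

definition incident_edges :: "'a graph \<Rightarrow> 'a \<Rightarrow> 'a set set" where
  "incident_edges G v = {e \<in> edges G. v \<in> e}"

definition regular :: "nat \<Rightarrow> 'a graph \<Rightarrow> bool" where
  "regular r G \<longleftrightarrow> (\<forall>v\<in>verts G. card (incident_edges G v) = r)"

text \<open>
  The palette at an isolated vertex is empty and is counted as an interval
  (take \<open>b < a\<close>). Properness of the coloring is the injectivity condition.
\<close>

definition interval_coloring :: "'a graph \<Rightarrow> nat \<Rightarrow> ('a set \<Rightarrow> nat) \<Rightarrow> bool" where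
  "interval_coloring G t \<alpha> \<longleftrightarrow>
     \<alpha> ` edges G = {1..t} \<and>
     (\<forall>v\<in>verts G. inj_on \<alpha> (incident_edges G v) \<and>
                  (\<exists>a b. \<alpha> ` incident_edges G v = {a..b}))"

definition interval_t_colorable :: "'a graph \<Rightarrow> nat \<Rightarrow> bool" where
  "interval_t_colorable G t \<longleftrightarrow> (\<exists>\<alpha>. interval_coloring G t \<alpha>)"

definition interval_colorable :: "'a graph \<Rightarrow> bool" where
  "interval_colorable G \<longleftrightarrow> (\<exists>t\<ge>1. interval_t_colorable G t)"

text \<open>
  Meaningful only for interval colorable finite graphs, where the number of
  colors is bounded by the number of edges, so that the maximum exists.
\<close>

definition W :: "'a graph \<Rightarrow> nat" where
  "W G = (GREATEST t. t \<ge> 1 \<and> interval_t_colorable G t)"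

text \<open>This is the cycle on \<open>m\<close> vertices for \<open>m \<ge> 3\<close> only.\<close>

definition cycle :: "nat \<Rightarrow> nat graph" where
  "cycle m = \<lparr>verts = {0..<m}, edges = {{i, (i + 1) mod m} | i. i < m}\<rparr>"

definition box_product :: "'a graph \<Rightarrow> 'b graph \<Rightarrow> ('a \<times> 'b) graph"  (infixl \<open>\<box>\<close> 70) where
  "G \<box> H = \<lparr>verts = verts G \<times> verts H,
            edges = {{(u1, v1), (u2, v2)} | u1 v1 u2 v2.
              u1 \<in> verts G \<and> u2 \<in> verts G \<and> v1 \<in> verts H \<and> v2 \<in> verts H \<and>
              (u1 = u2 \<and> {v1, v2} \<in> edges H \<or> v1 = v2 \<and> {u1, u2} \<in> edges G)}\<rparr>"

lemma simple_graph_cycle: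
  assumes "m \<ge> 3"
  shows "simple_graph (cycle m)"
proof -
  have "(i + 1) mod m < m \<and> (i + 1) mod m \<noteq> i" if "i < m" for i
    using assms that by (cases "i + 1 = m") auto
  then show ?thesis
    by (fastforce simp: simple_graph_def cycle_def card_2_iff)
qed

lemma simple_graph_box_product:
  assumes "simple_graph G" "simple_graph H"
  shows "simple_graph (G \<box> H)"
proof -
  have "a \<noteq> b" if "{a, b} \<in> edges G" for a b
    using assms(1) that by (auto simp: simple_graph_def)
  moreover have "a \<noteq> b" if "{a, b} \<in> edges H" for a b
    using assms(2) that by (auto simp: simple_graph_def)
  ultimately show ?thesis
    using assms by (fastforce simp: simple_graph_def box_product_def card_2_iff)
qed

lemma edges_box_product_iff:
  assumes "u1 \<in> verts G" "u2 \<in> verts G" "v1 \<in> verts H" "v2 \<in> verts H"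
  shows "{(u1, v1), (u2, v2)} \<in> edges (G \<box> H) \<longleftrightarrow>
    u1 = u2 \<and> {v1, v2} \<in> edges H \<or> v1 = v2 \<and> {u1, u2} \<in> edges G"
  using assms by (auto simp: box_product_def doubleton_eq_iff insert_commute)

end

theory Submission
  imports Defs
begin

text \<open>
  Write \<open>{a v..<a v + r}\<close> for the palette of a vertex \<open>v\<close> of \<open>G\<close>. The copies of \<open>G\<close> over the
  vertices \<open>0, \<dots>, 2n - 1\<close> of the cycle are colored by translates of an optimal coloring of \<open>G\<close>;
  a cycle edge in the fibre over \<open>v\<close> is colored \<open>a v\<close> plus a constant depending on that edge only.
  In the extremal copies \<open>0\<close> and \<open>n\<close> both cycle edges extend the palette on the same side, above in
  copy \<open>0\<close> and below in copy \<open>n\<close>; in every other copy there is one on each side. So each palette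
  becomes an interval of length \<open>r + 2\<close>, and along the cycle the translations grow to
  \<open>n (r + 1) + 1\<close>, which is the number of additional colors.
\<close>

section \<open>Maximal number of colors; palettes in regular graphs\<close>

lemma finite_edges: "simple_graph G \<Longrightarrow> finite (edges G)"
  by (rule finite_subset[of _ "Pow (verts G)"]) (auto simp: simple_graph_def)

lemma finite_incident_edges: "simple_graph G \<Longrightarrow> finite (incident_edges G v)"
  by (simp add: incident_edges_def finite_edges)

text \<open>Every color is used by some edge. This bound makes the \<open>GREATEST\<close> in
  \<open>W\<close> an attained maximum.\<close>

lemma interval_t_colorable_le_card_edges:
  assumes "simple_graph G" "interval_t_colorable G t"
  shows "t \<le> card (edges G)"
proof -
  obtain \<alpha> where "\<alpha> ` edges G = {1..t}"
    using assms(2) by (auto simp: interval_t_colorable_def interval_coloring_def)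
  then show ?thesis
    using card_image_le[OF finite_edges[OF assms(1)], of \<alpha>] by simp
qed

lemma le_W:
  assumes "simple_graph G" "interval_t_colorable G t" "t \<ge> 1"
  shows "t \<le> W G"
  unfolding W_def
  by (rule Greatest_le_nat[where b = "card (edges G)"])
    (use assms interval_t_colorable_le_card_edges in auto)

lemma W_attained:
  assumes "simple_graph G" "interval_colorable G"
  shows "W G \<ge> 1 \<and> interval_t_colorable G (W G)"
proof -
  obtain t where "t \<ge> 1 \<and> interval_t_colorable G t"
    using assms(2) by (auto simp: interval_colorable_def)
  then show ?thesis
    unfolding W_def
    by (rule GreatestI_nat[where b = "card (edges G)"])
      (use assms interval_t_colorable_le_card_edges in auto)
qed

text \<open>Properness gives each palette exactly \<open>r\<close> colors, so its least element
  determines it. The half-open form also covers the empty palette, where 1 serves as a conventional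
  start.\<close>

lemma regular_palette:
  assumes "interval_coloring G t \<alpha>" "regular r G" "v \<in> verts G"
  shows "\<exists>a\<ge>1. \<alpha> ` incident_edges G v = {a..<a + r}"
proof (cases "r = 0")
  case True
  obtain a b where ab: "\<alpha> ` incident_edges G v = {a..b}"
    and inj: "inj_on \<alpha> (incident_edges G v)"
    using assms unfolding interval_coloring_def by blast
  have "card {a..b} = 0"
    using card_image[OF inj] assms(2,3) ab True by (simp add: regular_def)
  then have "{a..b} = {1..<1 + r}"
    using True by simp
  then show ?thesis
    unfolding ab by blast
next
  case False
  obtain a b where ab: "\<alpha> ` incident_edges G v = {a..b}"
    and inj: "inj_on \<alpha> (incident_edges G v)"
    using assms unfolding interval_coloring_def by blast
  have card: "card {a..b} = r"
    using card_image[OF inj] assms(2,3) ab by (simp add: regular_def)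
  then have "a \<le> b" "Suc b = a + r"
    using False by simp_all
  then have eq: "{a..b} = {a..<a + r}" and "a \<in> {a..b}"
    by (simp_all add: atLeastLessThanSuc_atLeastAtMost[symmetric])
  then have "a \<in> \<alpha> ` edges G"
    using ab by (auto simp: incident_edges_def)
  then have "a \<ge> 1"
    using assms(1) by (auto simp: interval_coloring_def)
  then show ?thesis
    unfolding ab eq by blast
qed

subsection \<open>Interval colorings of cycles\<close>

definition cycle_edge :: "nat \<Rightarrow> nat \<Rightarrow> nat set" where
  "cycle_edge m i = {i, (i + 1) mod m}"

lemma verts_cycle: "verts (cycle m) = {..<m}"
  by (auto simp: cycle_def)

lemma edges_cycle: "edges (cycle m) = cycle_edge m ` {..<m}"
  by (auto simp: cycle_def cycle_edge_def)

lemma Suc_mod_if: "(i::nat) < m \<Longrightarrow> (i + 1) mod m = (if i + 1 = m then 0 else i + 1)"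
  by auto

text \<open>Distinct indices with the same edge would be successors of each other modulo
  \<open>m\<close>, forcing \<open>m\<close> to divide 2.\<close>

lemma inj_on_cycle_edge:
  assumes "m \<ge> 3"
  shows "inj_on (cycle_edge m) {..<m}"
proof (rule inj_onI)
  fix i j
  assume ij: "i \<in> {..<m}" "j \<in> {..<m}" and eq: "cycle_edge m i = cycle_edge m j"
  show "i = j"
  proof (rule ccontr)
    assume "i \<noteq> j"
    then have "i = (j + 1) mod m" "j = (i + 1) mod m"
      using eq by (auto simp: cycle_edge_def doubleton_eq_iff)
    then have "j + 1 = m \<and> i = 0 \<or> i = j + 1" "i + 1 = m \<and> j = 0 \<or> j = i + 1"
      using ij Suc_mod_if by (metis lessThan_iff)+
    then show False
      using assms by linarith
  qed
qed

lemma incident_edges_cycle: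
  assumes "i < m"
  shows "incident_edges (cycle m) i =
    {cycle_edge m i, cycle_edge m (if i = 0 then m - 1 else i - 1)}" (is "?L = ?R")
proof
  show "?L \<subseteq> ?R"
  proof
    fix c
    assume "c \<in> ?L"
    then obtain j where j: "j < m" "c = cycle_edge m j" "i \<in> cycle_edge m j"
      by (auto simp: incident_edges_def edges_cycle)
    then have "j = i \<or> i = (j + 1) mod m"
      by (auto simp: cycle_edge_def)
    then show "c \<in> ?R"
      using j by (cases "j + 1 = m") auto
  qed
  show "?R \<subseteq> ?L"
    using assms by (auto simp: incident_edges_def edges_cycle) (auto simp: cycle_edge_def)
qed

text \<open>Turns a function of edge indices into a function of edges; for \<open>m \<ge> 3\<close>
  the index of an edge is unique.\<close>

definition cycle_labelling :: "nat \<Rightarrow> (nat \<Rightarrow> 'b) \<Rightarrow> nat set \<Rightarrow> 'b" where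
  "cycle_labelling m f c = f (inv_into {..<m} (cycle_edge m) c)"

lemma cycle_labelling_cycle_edge:
  assumes "m \<ge> 3" "i < m"
  shows "cycle_labelling m f (cycle_edge m i) = f i"
  using assms by (simp add: cycle_labelling_def inv_into_f_f[OF inj_on_cycle_edge])

lemma cycle_labelling_incident_edges:
  assumes "m \<ge> 3" "i < m"
  shows "cycle_labelling m f ` incident_edges (cycle m) i =
    {f i, f (if i = 0 then m - 1 else i - 1)}"
  using assms by (auto simp: incident_edges_cycle cycle_labelling_cycle_edge)

text \<open>For \<open>r = 0\<close> this is the zigzag \<open>0, 1, \<dots>, n, n - 1, \<dots>, 1\<close>.\<close>

definition level :: "nat \<Rightarrow> nat \<Rightarrow> nat \<Rightarrow> nat" where
  "level n r i = (if i < n then i * (r + 1) + r else (2 * n - i) * (r + 1))"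

lemma consecutive_pair_interval:
  fixes x y :: nat
  assumes "x = y + 1 \<or> y = x + 1"
  shows "\<exists>a b. {x, y} = {a..b}"
proof -
  have "{y + 1, y} = {y..y + 1}" for y :: nat
    by auto
  then show ?thesis
    using assms by (metis insert_commute)
qed

text \<open>Cyclically consecutive terms of the zigzag differ by exactly 1, which yields both
  properness and the interval condition. Adding 1 makes the colors start at 1.\<close>

lemma cycle_coloring:
  assumes "n \<ge> 2"
  shows "interval_t_colorable (cycle (2 * n)) (n + 1)"
proof -
  let ?m = "2 * n"
  let ?f = "\<lambda>i. level n 0 i + 1"
  let ?c = "cycle_labelling ?m ?f"
  have m: "?m \<ge> 3"
    using assms by simp
  have "?c ` edges (cycle ?m) = ?f ` {..<?m}"
    unfolding edges_cycle image_image
    by (rule image_cong) (simp_all add: cycle_labelling_cycle_edge[OF m])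
  also have "\<dots> = {1..n + 1}"
  proof
    show "?f ` {..<?m} \<subseteq> {1..n + 1}"
      by (auto simp: level_def)
    show "{1..n + 1} \<subseteq> ?f ` {..<?m}"
    proof
      fix k
      assume "k \<in> {1..n + 1}"
      \<comment> \<open>The rising half together with its peak at index \<open>n\<close> already
        takes every value.\<close>
      then have "k = ?f (k - 1) \<and> k - 1 < ?m"
        using assms by (auto simp: level_def)
      then show "k \<in> ?f ` {..<?m}"
        by blast
    qed
  qed
  finally have img: "?c ` edges (cycle ?m) = {1..n + 1}" .
  have "inj_on ?c (incident_edges (cycle ?m) i) \<and> (\<exists>a b. ?c ` incident_edges (cycle ?m) i = {a..b})"
    if i: "i < ?m" for i
  proof -
    let ?j = "if i = 0 then ?m - 1 else i - 1"
    have j: "?j < ?m"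
      using i by auto
    have d: "?f i = ?f ?j + 1 \<or> ?f ?j = ?f i + 1"
      using i assms by (auto simp: level_def)
    have "?c (cycle_edge ?m i) \<noteq> ?c (cycle_edge ?m ?j)"
      unfolding cycle_labelling_cycle_edge[OF m i] cycle_labelling_cycle_edge[OF m j]
      using d by linarith
    moreover have "inj_on f {x, y}" if "f x \<noteq> f y" for f :: "nat set \<Rightarrow> nat" and x y
      using that by (auto simp: inj_on_def)
    ultimately have "inj_on ?c (incident_edges (cycle ?m) i)"
      unfolding incident_edges_cycle[OF i] by blast
    moreover have "\<exists>a b. ?c ` incident_edges (cycle ?m) i = {a..b}"
      unfolding cycle_labelling_incident_edges[OF m i]
      by (rule consecutive_pair_interval[OF d])
    ultimately show ?thesis
      by blast
  qed
  then have "interval_coloring (cycle ?m) (n + 1) ?c"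
    using img by (auto simp: interval_coloring_def verts_cycle)
  then show ?thesis
    by (auto simp: interval_t_colorable_def)
qed

section \<open>Upper bound for the number of colors of an even cycle\<close>

lemma interval_card_2_dist:
  fixes x y :: nat
  assumes "{x, y} = {a..b}"
  shows "\<bar>int x - int y\<bar> \<le> 1"
proof -
  have "card {a..b} \<le> 2"
    unfolding assms[symmetric] by (simp add: card_insert_if)
  moreover have "x \<in> {a..b}" "y \<in> {a..b}"
    unfolding assms[symmetric] by auto
  ultimately show ?thesis
    by auto
qed

lemma dist_le_steps:
  fixes g :: "nat \<Rightarrow> int"
  assumes "\<And>k. i \<le> k \<Longrightarrow> k < j \<Longrightarrow> \<bar>g (Suc k) - g k\<bar> \<le> 1" "i \<le> j"
  shows "\<bar>g j - g i\<bar> \<le> int (j - i)"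
  using assms(2,1)
proof (induction j rule: dec_induct)
  case base
  then show ?case by simp
next
  case (step k)
  have "\<bar>g k - g i\<bar> \<le> int (k - i)" "\<bar>g (Suc k) - g k\<bar> \<le> 1"
    using step by auto
  then show ?case
    using step.hyps by (simp add: of_nat_diff)
qed

text \<open>Colors of adjacent edges differ by at most 1. Of the two ways around the cycle from an
  edge of color 1 to an edge of color \<open>t\<close>, one takes at most \<open>n\<close> steps, so
  \<open>t - 1 \<le> n\<close>.\<close>

lemma cycle_coloring_le:
  assumes "n \<ge> 2" "interval_t_colorable (cycle (2 * n)) t"
  shows "t \<le> n + 1"
proof (cases "t = 0")
  case False
  let ?m = "2 * n"
  obtain c where c: "interval_coloring (cycle ?m) t c"
    using assms(2) unfolding interval_t_colorable_def by blast
  define g where "g i = int (c (cycle_edge ?m i))" for i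
  have adjacent: "\<bar>g i - g (if i = 0 then ?m - 1 else i - 1)\<bar> \<le> 1" if "i < ?m" for i
  proof -
    have "i \<in> verts (cycle ?m)"
      using that by (simp add: verts_cycle)
    then obtain a b where "c ` incident_edges (cycle ?m) i = {a..b}"
      using c unfolding interval_coloring_def by blast
    then show ?thesis
      unfolding g_def incident_edges_cycle[OF that] image_insert image_empty
      by (rule interval_card_2_dist)
  qed
  have wrap: "\<bar>g 0 - g (?m - 1)\<bar> \<le> 1"
    using adjacent[of 0] assms(1) by simp
  have steps: "\<bar>g j - g i\<bar> \<le> int (j - i)" if "i \<le> j" "j < ?m" for i j
    by (rule dist_le_steps) (use that adjacent[of "Suc _"] in auto)
  have bound: "\<bar>g j - g i\<bar> \<le> int n" if ij: "i \<le> j" "j < ?m" for i j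
  proof (cases "j - i \<le> n")
    case True
    then show ?thesis
      using steps[OF ij] by linarith
  next
    case False
    \<comment> \<open>The other way around: from \<open>i\<close> down to 0, one step across to the
      last edge, then down to \<open>j\<close>; \<open>2 * n - (j - i)\<close> steps in all.\<close>
    have "\<bar>g i - g 0\<bar> \<le> int i" "\<bar>g (?m - 1) - g j\<bar> \<le> int (?m - 1 - j)"
      using steps[of 0 i] steps[of j "?m - 1"] ij by simp_all
    moreover have "int i + int (?m - 1 - j) + 1 \<le> int n"
      using False ij by linarith
    ultimately show ?thesis
      using wrap by linarith
  qed
  have img: "c ` cycle_edge ?m ` {..<?m} = {1..t}"
    using c unfolding interval_coloring_def edges_cycle by blast
  have "\<exists>i<?m. c (cycle_edge ?m i) = k" if "k \<in> {1..t}" for k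
    using that unfolding img[symmetric] by auto
  from this[of 1] this[of t] obtain i j where ij: "i < ?m" "j < ?m"
    and "c (cycle_edge ?m i) = 1" "c (cycle_edge ?m j) = t"
    using False by auto
  then have "g i = 1" "g j = int t"
    by (simp_all add: g_def)
  moreover have "\<bar>g j - g i\<bar> \<le> int n"
    using bound[of i j] bound[of j i] ij by (cases "i \<le> j") (simp_all add: abs_minus_commute)
  ultimately show ?thesis
    by linarith
qed simp

subsection \<open>Colorings of box products\<close>

text \<open>Writing edges as rectangles lets the two projections tell the kinds of edges apart and
  recover the underlying edge.\<close>

lemma edges_box_product:
  assumes "simple_graph G" "simple_graph H"
  shows "edges (G \<box> H) =
    {e \<times> {w} | e w. e \<in> edges G \<and> w \<in> verts H} \<union> {{v} \<times> f | v f. v \<in> verts G \<and> f \<in> edges H}"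
    (is "_ = ?E \<union> ?F")
proof
  have *: "{u1, u2} \<times> {w} = {(u1, w), (u2, w)}" "{v} \<times> {w1, w2} = {(v, w1), (v, w2)}"
    for u1 u2 v :: 'a and w w1 w2 :: 'b
    by auto
  show "edges (G \<box> H) \<subseteq> ?E \<union> ?F"
  proof
    fix x
    assume "x \<in> edges (G \<box> H)"
    then obtain u1 v1 u2 v2 where x: "x = {(u1, v1), (u2, v2)}"
      and V: "u1 \<in> verts G" "v1 \<in> verts H"
      and E: "u1 = u2 \<and> {v1, v2} \<in> edges H \<or> v1 = v2 \<and> {u1, u2} \<in> edges G"
      by (auto simp: box_product_def)
    from E show "x \<in> ?E \<union> ?F"
    proof (elim disjE conjE)
      assume "u1 = u2" "{v1, v2} \<in> edges H"
      then have "x = {u1} \<times> {v1, v2}"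
        unfolding x * by simp
      then show ?thesis
        using V \<open>{v1, v2} \<in> edges H\<close> by blast
    next
      assume "v1 = v2" "{u1, u2} \<in> edges G"
      then have "x = {u1, u2} \<times> {v1}"
        unfolding x * by simp
      then show ?thesis
        using V \<open>{u1, u2} \<in> edges G\<close> by blast
    qed
  qed
  have "e \<times> {w} \<in> edges (G \<box> H)" if ew: "e \<in> edges G" "w \<in> verts H" for e w
  proof -
    obtain x y where "e = {x, y}" "x \<in> verts G" "y \<in> verts G"
      using assms(1) ew by (fastforce simp: simple_graph_def card_2_iff)
    then show ?thesis
      using ew by (auto simp: * edges_box_product_iff)
  qed
  moreover have "{v} \<times> f \<in> edges (G \<box> H)" if vf: "v \<in> verts G" "f \<in> edges H" for v f
  proof -
    obtain x y where "f = {x, y}" "x \<in> verts H" "y \<in> verts H"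
      using assms(2) vf by (fastforce simp: simple_graph_def card_2_iff)
    then show ?thesis
      using vf by (auto simp: * edges_box_product_iff)
  qed
  ultimately show "?E \<union> ?F \<subseteq> edges (G \<box> H)"
    by blast
qed

lemma incident_edges_box_product:
  assumes "simple_graph G" "simple_graph H" "v \<in> verts G" "w \<in> verts H"
  shows "incident_edges (G \<box> H) (v, w) =
    (\<lambda>e. e \<times> {w}) ` incident_edges G v \<union> (\<lambda>f. {v} \<times> f) ` incident_edges H w"
  unfolding incident_edges_def edges_box_product[OF assms(1,2)]
  using assms(3,4) by blast

text \<open>An edge lies in a copy of the first factor iff its second projection is a singleton.
  Such edges are translated by an amount \<open>s\<close> of the copy, the others by an amount
  \<open>a\<close> of the fibre.\<close>

definition product_coloring ::
  "('a set \<Rightarrow> nat) \<Rightarrow> ('b \<Rightarrow> nat) \<Rightarrow> ('a \<Rightarrow> nat) \<Rightarrow> ('b set \<Rightarrow> nat) \<Rightarrow> ('a \<times> 'b) set \<Rightarrow> nat" where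
  "product_coloring \<alpha> s a \<gamma> e =
    (if card (snd ` e) = 1 then \<alpha> (fst ` e) + s (the_elem (snd ` e))
     else a (the_elem (fst ` e)) + \<gamma> (snd ` e))"

lemma product_coloring_simps:
  "card e = 2 \<Longrightarrow> product_coloring \<alpha> s a \<gamma> (e \<times> {w}) = \<alpha> e + s w"
  "card f = 2 \<Longrightarrow> product_coloring \<alpha> s a \<gamma> ({v} \<times> f) = a v + \<gamma> f"
  by (auto simp: product_coloring_def card_2_iff)

lemma product_coloring_palette:
  assumes "simple_graph G" "simple_graph H" "v \<in> verts G" "w \<in> verts H"
  shows "product_coloring \<alpha> s a \<gamma> ` incident_edges (G \<box> H) (v, w) =
    (\<lambda>k. k + s w) ` \<alpha> ` incident_edges G v \<union> (\<lambda>k. a v + k) ` \<gamma> ` incident_edges H w"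
proof -
  have "card e = 2" if "e \<in> incident_edges G v" for e
    using assms that by (auto simp: incident_edges_def simple_graph_def)
  moreover have "card f = 2" if "f \<in> incident_edges H w" for f
    using assms that by (auto simp: incident_edges_def simple_graph_def)
  ultimately show ?thesis
    unfolding incident_edges_box_product[OF assms] image_Un image_image
    by (intro arg_cong2[of _ _ _ _ "(\<union>)"] image_cong) (simp_all add: product_coloring_simps)
qed

section \<open>Palettes in the product with an even cycle\<close>

lemma edges_eq_Union_incident_edges:
  assumes "simple_graph G"
  shows "edges G = (\<Union>v\<in>verts G. incident_edges G v)"
proof -
  have "\<exists>v\<in>verts G. v \<in> e" if "e \<in> edges G" for e
    using assms that by (fastforce simp: simple_graph_def card_2_iff)
  then show ?thesis
    by (auto simp: incident_edges_def)
qed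

text \<open>Translation of copy \<open>i\<close> of \<open>G\<close>. Neighboring copies differ by
  \<open>r + 1\<close>, except that the steps from \<open>n - 1\<close> to \<open>n\<close> and from
  \<open>2 * n - 1\<close> back to 0 have size \<open>r + 2\<close>, owing to the summand 1.\<close>

definition shift :: "nat \<Rightarrow> nat \<Rightarrow> nat \<Rightarrow> nat" where
  "shift n r i = (if i < n then i * (r + 1) else (2 * n - i) * (r + 1) + 1)"

text \<open>Offset from \<open>a v\<close> of the least color at \<open>(v, i)\<close>:
  \<open>shift n r i\<close> minus the number (0, 1 or 2) of cycle edges there colored below the
  block of \<open>G\<close>.\<close>

definition palette_start :: "nat \<Rightarrow> nat \<Rightarrow> nat \<Rightarrow> nat" where
  "palette_start n r i =
    (if i = 0 then 0 else if i \<le> n then i * (r + 1) - 1 else (2 * n - i) * (r + 1))"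

lemma shift_level_palette:
  assumes "n \<ge> 2" "i < 2 * n"
  shows "(\<lambda>k. k + shift n r i) ` {a..<a + r} \<union>
      (\<lambda>k. a + k) ` {level n r i, level n r (if i = 0 then 2 * n - 1 else i - 1)} =
    {a + palette_start n r i..a + palette_start n r i + r + 1}" (is "?L = ?R")
proof -
  consider "i = 0" | k where "i = Suc k" "i < n" | k where "i = n" "n = Suc k"
    | k where "i > n" "2 * n - i = Suc k" "2 * n - (i - 1) = Suc (Suc k)"
  proof (cases "i \<le> n")
    case False
    then show ?thesis
      using assms that(4)[of "2 * n - i - 1"] by simp
  qed (use assms that in \<open>cases i; force\<close>)
  \<comment> \<open>The cycle edges lie both above the block of \<open>r\<close> colors (copy 0),
    one on each side, or both below (copy \<open>n\<close>).\<close>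
  then have "shift n r i = palette_start n r i \<and>
        {level n r i, level n r (if i = 0 then 2 * n - 1 else i - 1)} =
        {palette_start n r i + r, palette_start n r i + r + 1} \<or>
      shift n r i = palette_start n r i + 1 \<and>
        {level n r i, level n r (if i = 0 then 2 * n - 1 else i - 1)} =
        {palette_start n r i, palette_start n r i + r + 1} \<or>
      shift n r i = palette_start n r i + 2 \<and>
        {level n r i, level n r (if i = 0 then 2 * n - 1 else i - 1)} =
        {palette_start n r i, palette_start n r i + 1}"
    by cases (use assms in \<open>auto simp: shift_def level_def palette_start_def\<close>)
  moreover have "(\<lambda>k. k + d) ` {a..<a + r} = {a + d..<a + d + r}" for d
    by (simp add: add.commute add.left_commute)
  ultimately show ?thesis
    by (elim disjE conjE) (simp_all only:, auto)
qed

text \<open>The maximum is reached in copy \<open>n\<close>, with equality. This bound keeps all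
  colors of the product within the intended range.\<close>

lemma palette_start_le:
  assumes "n \<ge> 2"
  shows "palette_start n r i + 1 \<le> n * (r + 1)"
proof -
  have "(2 * n - i) * (r + 1) \<le> (n - 1) * (r + 1)" if "i > n"
    using that by (intro mult_right_mono) auto
  moreover have "i * (r + 1) \<le> n * (r + 1)" if "i \<le> n"
    using that by (intro mult_right_mono) auto
  moreover have "(n - 1) * (r + 1) + 1 \<le> n * (r + 1)" "1 \<le> n * (r + 1)"
    using assms by (cases n; simp)+
  ultimately show ?thesis
    by (auto simp: palette_start_def)
qed

lemma box_product_cycle_coloring:
  assumes G: "simple_graph G" "regular r G"
    and t: "t \<ge> 1" "interval_t_colorable G t" and n: "n \<ge> 2"
  shows "interval_t_colorable (G \<box> cycle (2 * n)) (t + n * (r + 1) + 1)"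
proof -
  let ?m = "2 * n" and ?P = "palette_start n r" and ?T = "t + n * (r + 1) + 1"
  let ?GC = "G \<box> cycle ?m"
  have m: "?m \<ge> 3"
    using n by simp
  have C: "simple_graph (cycle ?m)"
    by (rule simple_graph_cycle[OF m])
  have GC: "simple_graph ?GC"
    by (rule simple_graph_box_product[OF G(1) C])
  obtain \<alpha> where \<alpha>: "interval_coloring G t \<alpha>"
    using t by (auto simp: interval_t_colorable_def)
  obtain a where a: "\<And>v. v \<in> verts G \<Longrightarrow> a v \<ge> 1 \<and> \<alpha> ` incident_edges G v = {a v..<a v + r}"
    using regular_palette[OF \<alpha> G(2)] by metis
  have img: "\<alpha> ` edges G = {1..t}"
    using \<alpha> by (simp add: interval_coloring_def)
  define \<beta> where "\<beta> = product_coloring \<alpha> (shift n r) a (cycle_labelling ?m (level n r))"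
  have palette: "\<beta> ` incident_edges ?GC (v, i) = {a v + ?P i..a v + ?P i + r + 1}"
    if "v \<in> verts G" "i < ?m" for v i
    unfolding \<beta>_def using that a[OF that(1)]
    by (simp only: product_coloring_palette[OF G(1) C] cycle_labelling_incident_edges[OF m]
        verts_cycle lessThan_iff shift_level_palette[OF n])
  \<comment> \<open>A vertex on an edge of color 1 has a palette starting at 1. Its fibre will
    supply the low colors.\<close>
  have "1 \<in> \<alpha> ` edges G"
    unfolding img using t by simp
  then obtain v where v: "v \<in> verts G" "1 \<in> \<alpha> ` incident_edges G v"
    unfolding edges_eq_Union_incident_edges[OF G(1)] by blast
  then have av: "a v = 1" and r: "r \<ge> 1"
    using a[OF v(1)] by auto
  have inj: "inj_on \<beta> (incident_edges ?GC (v, i))" if vi: "v \<in> verts G" "i < ?m" for v i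
  proof -
    have i: "i \<in> verts (cycle ?m)"
      using vi by (simp add: verts_cycle)
    have "card (incident_edges ?GC (v, i)) \<le>
        card (incident_edges G v) + card (incident_edges (cycle ?m) i)"
      unfolding incident_edges_box_product[OF G(1) C vi(1) i]
      by (intro order_trans[OF card_Un_le] add_mono card_image_le finite_incident_edges G(1) C)
    also have "\<dots> \<le> r + 2"
      using G(2) vi by (simp add: regular_def incident_edges_cycle card_insert_if)
    \<comment> \<open>Properness by counting: at most \<open>r + 2\<close> edges carry the
      \<open>r + 2\<close> colors of the palette, so none repeats.\<close>
    finally have "card (incident_edges ?GC (v, i)) \<le> card (\<beta> ` incident_edges ?GC (v, i))"
      unfolding palette[OF vi] by simp
    then show ?thesis
      by (intro eq_card_imp_inj_on finite_incident_edges GC le_antisym card_image_le)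
  qed
  have "\<beta> ` edges ?GC = {1..?T}"
  proof
    have sub: "{a v + ?P i..a v + ?P i + r + 1} \<subseteq> {1..?T}" if "v \<in> verts G" for v i
    proof -
      \<comment> \<open>As \<open>r \<ge> 1\<close>, this is the largest color at \<open>v\<close>
        in \<open>G\<close>, hence at most \<open>t\<close>; the extended palette then ends at
        \<open>?T\<close> or earlier.\<close>
      have "a v + r - 1 \<in> \<alpha> ` incident_edges G v"
        using a[OF that] r by auto
      then have "a v + r - 1 \<in> \<alpha> ` edges G"
        by (auto simp: incident_edges_def)
      then have "a v + r - 1 \<le> t"
        unfolding img by simp
      then show ?thesis
        using a[OF that] palette_start_le[OF n, of r i] by auto
    qed
    show "\<beta> ` edges ?GC \<subseteq> {1..?T}"
    proof
      fix k
      assume "k \<in> \<beta> ` edges ?GC"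
      then obtain x where x: "x \<in> verts ?GC" "k \<in> \<beta> ` incident_edges ?GC x"
        unfolding edges_eq_Union_incident_edges[OF GC] by blast
      moreover obtain v i where "x = (v, i)" "v \<in> verts G" "i < ?m"
        using x(1) by (auto simp: box_product_def verts_cycle)
      ultimately show "k \<in> {1..?T}"
        using palette sub by blast
    qed
    show "{1..?T} \<subseteq> \<beta> ` edges ?GC"
    proof
      fix k
      assume k: "k \<in> {1..?T}"
      show "k \<in> \<beta> ` edges ?GC"
      proof (cases "k \<le> n * (r + 1) + 1")
        case True
        \<comment> \<open>The palettes of \<open>v\<close> in the copies \<open>0, \<dots>, n\<close> overlap successively.\<close>
        define q where "q = k div (r + 1)"
        define d where "d = k mod (r + 1)"
        have k_eq: "k = q * (r + 1) + d"
          unfolding q_def d_def by (rule div_mult_mod_eq[symmetric])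
        have d: "d \<le> r"
          unfolding d_def using mod_less_divisor[of "r + 1" k] by simp
        have q: "q \<le> n"
        proof (rule ccontr)
          assume "\<not> q \<le> n"
          \<comment> \<open>Since \<open>r \<ge> 1\<close>, the left side exceeds
            \<open>n * (r + 1) + 1\<close>, the bound on \<open>k\<close>.\<close>
          then have "(n + 1) * (r + 1) \<le> q * (r + 1)"
            by (intro mult_right_mono) simp_all
          then show False
            using True k_eq r by simp
        qed
        have "k \<in> {a v + ?P q..a v + ?P q + r + 1}"
        \<comment> \<open>For \<open>q > 0\<close> the palette in copy \<open>q\<close> starts
          exactly at \<open>q * (r + 1)\<close>; for \<open>q = 0\<close> it starts at 1, and
          \<open>k \<ge> 1\<close> is used.\<close>
        proof (cases "q = 0")
          case True
          then show ?thesis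
            using k k_eq d by (simp add: av palette_start_def)
        next
          case False
          then have "?P q + 1 = q * (r + 1)"
            using q by (simp add: palette_start_def)
          then show ?thesis
            using k_eq d unfolding av atLeastAtMost_iff by linarith
        qed
        moreover have "q < ?m"
          using q n by simp
        ultimately show ?thesis
          using palette[OF v(1), of q] unfolding incident_edges_def by blast
      next
        case False
        \<comment> \<open>The remaining colors are the \<open>t\<close> colors of \<open>G\<close>
          translated by \<open>n * (r + 1) + 1\<close>, all found in copy \<open>n\<close>.\<close>
        then have "k - shift n r n \<in> \<alpha> ` edges G"
          using k unfolding img by (auto simp: shift_def)
        then obtain e where e: "e \<in> edges G" "\<alpha> e = k - shift n r n"
          by auto
        then have "\<beta> (e \<times> {n}) = k"
          using G(1) False unfolding \<beta>_def
          by (subst product_coloring_simps) (auto simp: simple_graph_def shift_def)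
        moreover have "n \<in> verts (cycle ?m)"
          using n by (simp add: verts_cycle)
        then have "e \<times> {n} \<in> edges ?GC"
          unfolding edges_box_product[OF G(1) C] using e by blast
        ultimately show ?thesis
          by blast
      qed
    qed
  qed
  moreover have "inj_on \<beta> (incident_edges ?GC x) \<and> (\<exists>p q. \<beta> ` incident_edges ?GC x = {p..q})"
    if "x \<in> verts ?GC" for x
    using that inj palette by (cases x) (auto simp: box_product_def verts_cycle)
  ultimately show ?thesis
    unfolding interval_t_colorable_def interval_coloring_def by blast
qed

theorem theorem10:
  fixes G :: "'a graph" and r n :: nat
  assumes "simple_graph G"
    and "regular r G"
    and "interval_colorable G"
    and "n \<ge> 2"
  shows "interval_colorable (G \<box> cycle (2 * n))
       \<and> W (G \<box> cycle (2 * n)) \<ge> W G + W (cycle (2 * n)) + n * r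
       \<and> interval_colorable (cycle (2 * n))
       \<and> W (cycle (2 * n)) = n + 1"
proof -
  have C: "simple_graph (cycle (2 * n))"
    using assms(4) by (intro simple_graph_cycle) simp
  have col_C: "interval_colorable (cycle (2 * n))"
    using cycle_coloring[OF assms(4)] unfolding interval_colorable_def
    by (intro exI[of _ "n + 1"]) simp
  have W_C: "W (cycle (2 * n)) = n + 1"
    using W_attained[OF C col_C] cycle_coloring_le[OF assms(4)]
      le_W[OF C cycle_coloring[OF assms(4)]] by (simp add: le_antisym)
  \<comment> \<open>With \<open>t = W G\<close>, the additional \<open>n * (r + 1) + 1\<close>
    colors split as \<open>(n + 1) + n * r\<close>, the first part being the value of
    \<open>W\<close> for the cycle.\<close>
  have col: "interval_t_colorable (G \<box> cycle (2 * n)) (W G + n * (r + 1) + 1)"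
    using W_attained[OF assms(1,3)] box_product_cycle_coloring[OF assms(1,2)] assms(4) by blast
  then have "interval_colorable (G \<box> cycle (2 * n))"
    unfolding interval_colorable_def by (intro exI[of _ "W G + n * (r + 1) + 1"]) simp
  moreover have "W G + n * (r + 1) + 1 \<le> W (G \<box> cycle (2 * n))"
    using le_W[OF simple_graph_box_product[OF assms(1) C] col] by simp
  ultimately show ?thesis
    using col_C W_C by (simp add: algebra_simps)
qed

end
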